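(* Let $\mathcal{A}$ be a unital Banach algebra and $\Omega\subset\mathcal{A}$ an open subset. Let $f_t:\Omega\to\Omega$, $t\ge0$, be a composition semigroup of analytic functions. Assume that for every $b'\in\Omega$ there exists $\delta>0$ such that \begin{enumerate} \item[(a)] $f_t(b)-b\to0$ as $t\downarrow0$, uniformly over $b\in B_\delta(b')$; \item[(b)] for any $T>0$, $f_t(b)-b$ is uniformly bounded over $b\in B_\delta(b')$ and $t\in[0,T]$. \end{enumerate} Then there exists an analytic function $\Phi:\Omega\to\mathcal{A}$ such that $$\frac{df_t(b)}{dt}=-\Phi(f_t(b))\qquad\text{for all }b\in\Omega,\ t\ge0.$$
   Context: A composition semigroup is a family with $f_0=\mathrm{id}$ and $f_{s+t}=f_s\circ f_t$ for $s,t\ge0$. $B_\delta(b')$ denotes the open ball of radius $\delta$ about $b'$, taken inside $\Omega$. Analytic means Gâteaux differentiable (in the complex sense) and locally bounded. *)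

theory Defs
  imports "HOL-Analysis.Analysis"
begin

text \<open>Complex unital Banach algebras, normalised by \<open>norm 1 = 1\<close> as in
  \<^class>\<open>real_normed_algebra_1\<close>. The library provides real scalars only, so a complex scalar
  multiplication extending \<^const>\<open>scaleR\<close> is added.\<close>

class complex_banach_algebra_1 = real_normed_algebra_1 + banach +
  fixes scaleC :: "complex \<Rightarrow> 'a \<Rightarrow> 'a"  (infixr "*\<^sub>C" 75)
  assumes scaleC_add_right: "c *\<^sub>C (x + y) = c *\<^sub>C x + c *\<^sub>C y"
    and scaleC_add_left: "(c + d) *\<^sub>C x = c *\<^sub>C x + d *\<^sub>C x"
    and scaleC_scaleC: "c *\<^sub>C (d *\<^sub>C x) = (c * d) *\<^sub>C x"
    and scaleC_complex_of_real: "complex_of_real r *\<^sub>C x = r *\<^sub>R x"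
    and mult_scaleC_left: "(c *\<^sub>C x) * y = c *\<^sub>C (x * y)"
    and mult_scaleC_right: "x * (c *\<^sub>C y) = c *\<^sub>C (x * y)"
    and norm_scaleC: "norm (c *\<^sub>C x) = cmod c * norm x"

instantiation complex :: complex_banach_algebra_1
begin

definition scaleC_complex :: "complex \<Rightarrow> complex \<Rightarrow> complex"
  where "scaleC_complex c x = c * x"

instance
  by standard (auto simp: scaleC_complex_def algebra_simps norm_mult scaleR_conv_of_real)

end

text \<open>Only existence of all complex directional derivatives is required; neither linearity nor
  continuity in the direction \<open>h\<close> is part of the definition.\<close>

definition gateaux_differentiable_at ::
    "('a::complex_banach_algebra_1 \<Rightarrow> 'a) \<Rightarrow> 'a \<Rightarrow> bool"
  where "gateaux_differentiable_at F b \<longleftrightarrow>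
    (\<forall>h. \<exists>D. ((\<lambda>z::complex. inverse z *\<^sub>C (F (b + z *\<^sub>C h) - F b)) \<longlongrightarrow> D) (at 0))"

definition locally_bounded_on ::
    "'a::real_normed_vector set \<Rightarrow> ('a \<Rightarrow> 'b::real_normed_vector) \<Rightarrow> bool"
  where "locally_bounded_on \<Omega> F \<longleftrightarrow> (\<forall>b\<in>\<Omega>. \<exists>\<delta>>0. bounded (F ` (ball b \<delta> \<inter> \<Omega>)))"

text \<open>Used for open \<open>\<Omega>\<close>, where the values of \<open>F\<close> outside \<open>\<Omega>\<close> are irrelevant.\<close>

definition banach_analytic_on ::
    "'a::complex_banach_algebra_1 set \<Rightarrow> ('a \<Rightarrow> 'a) \<Rightarrow> bool"
  where "banach_analytic_on \<Omega> F \<longleftrightarrow>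
    (\<forall>b\<in>\<Omega>. gateaux_differentiable_at F b) \<and> locally_bounded_on \<Omega> F"

definition composition_semigroup_on :: "'a set \<Rightarrow> (real \<Rightarrow> 'a \<Rightarrow> 'a) \<Rightarrow> bool"
  where "composition_semigroup_on \<Omega> f \<longleftrightarrow>
    (\<forall>t\<ge>0. f t ` \<Omega> \<subseteq> \<Omega>) \<and>
    (\<forall>b\<in>\<Omega>. f 0 b = b) \<and>
    (\<forall>s\<ge>0. \<forall>t\<ge>0. \<forall>b\<in>\<Omega>. f (s + t) b = f s (f t b))"

end

theory Submission
  imports Defs "HOL-Complex_Analysis.Cauchy_Integral_Formula"
begin

text \<open>Write \<open>g\<^sub>t b = f\<^sub>t b - b\<close>. The generator has to be \<open>\<Phi> b = - lim g\<^sub>h b / h\<close> as \<open>h \<down> 0\<close>, and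
  everything rests on two facts about \<open>g\<close>.

  First, a bounded Gateaux differentiable map is Lipschitz on a smaller ball, with a constant
  proportional to its bound (lemma \<open>bounded_gateaux_lipschitz\<close>). This is the Cauchy inequality on
  complex lines, transferred to vector values by composing with complex linear functionals that
  norm a given vector up to a factor 2. The Hahn--Banach theorem provides them, and it is
  obtained here from the fact that minimal sublinear functionals are linear.

  Second, the semigroup law gives
  \<open>f\<^bsub>(k+1)h\<^esub> b - f\<^bsub>kh\<^esub> b = g\<^sub>h b + (g\<^bsub>kh\<^esub> (f\<^sub>h b) - g\<^bsub>kh\<^esub> b)\<close>, so that \<open>g\<^bsub>nh\<^esub> b\<close> is
  \<open>n g\<^sub>h b\<close> up to a relative error given by the Lipschitz constants of \<open>g\<^bsub>kh\<^esub>\<close>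
  (lemma \<open>displacement_iterate\<close>). The uniform convergence \<open>g\<^sub>t \<rightarrow> 0\<close> makes these
  constants at most \<open>1/2\<close> for small times; since \<open>g\<^bsub>nh\<^esub>\<close> stays bounded with \<open>nh\<close> of a
  fixed size, \<open>g\<^sub>h = O(h)\<close> locally uniformly (lemma \<open>displacement_linear_bound\<close>). Feeding this
  back, the Lipschitz constant of \<open>g\<^sub>h\<close> is itself \<open>O(h)\<close>, hence
  \<open>g\<^bsub>nh\<^esub> - n g\<^sub>h = O((nh)\<^sup>2)\<close>, and \<open>g\<^sub>h b / h\<close> is Cauchy as \<open>h \<down> 0\<close>.

  The limit is analytic because the Cauchy estimates that force complex difference quotients to
  converge depend only on a bound, and therefore survive pointwise limits
  (lemma \<open>bounded_gateaux_limit\<close>). The right derivative of an orbit is immediate from the semigroup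
  law. For the left derivative, the orbit is left continuous, because the bound on
  \<open>g\<^sub>s\<close> for \<open>s\<close> in bounded intervals makes the maps \<open>f\<^sub>s\<close> uniformly Lipschitz near a
  point, and the \<open>O(h)\<close> Lipschitz constant of \<open>g\<^sub>h\<close> lets the base point of \<open>g\<^sub>h / h\<close> move along with \<open>h\<close>.\<close>

section \<open>Norming functionals\<close>

definition sublinear :: "('v::real_vector \<Rightarrow> real) \<Rightarrow> bool"
  where "sublinear p \<longleftrightarrow>
    (\<forall>x y. p (x + y) \<le> p x + p y) \<and> (\<forall>t\<ge>0. \<forall>x. p (t *\<^sub>R x) \<le> t * p x)"

lemma sublinearI:
  assumes "\<And>x y. p (x + y) \<le> p x + p y" and "\<And>t x. t \<ge> 0 \<Longrightarrow> p (t *\<^sub>R x) \<le> t * p x"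
  shows "sublinear p"
  using assms by (simp add: sublinear_def)

lemma sublinear_add: "sublinear p \<Longrightarrow> p (x + y) \<le> p x + p y"
  by (simp add: sublinear_def)

lemma sublinear_scale_le: "sublinear p \<Longrightarrow> t \<ge> 0 \<Longrightarrow> p (t *\<^sub>R x) \<le> t * p x"
  by (simp add: sublinear_def)

lemma sublinear_zero:
  assumes "sublinear p"
  shows "p 0 = 0"
proof (rule antisym)
  show "p 0 \<le> 0"
    using sublinear_scale_le[OF assms, of 0 0] by simp
  show "0 \<le> p 0"
    using sublinear_add[OF assms, of 0 0] by simp
qed

lemma sublinear_scale:
  assumes "sublinear p" "t \<ge> 0"
  shows "p (t *\<^sub>R x) = t * p x"
proof (cases "t = 0")
  case True
  then show ?thesis
    using sublinear_zero[OF assms(1)] by simp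
next
  case False
  with assms(2) have t: "t > 0"
    by simp
  then have "p x \<le> inverse t * p (t *\<^sub>R x)"
    using sublinear_scale_le[OF assms(1), of "inverse t" "t *\<^sub>R x"] by simp
  then have "t * p x \<le> p (t *\<^sub>R x)"
    using t by (simp add: field_simps)
  then show ?thesis
    using sublinear_scale_le[OF assms, of x] by linarith
qed

lemma sublinear_ge: "sublinear p \<Longrightarrow> - p (- x) \<le> p x"
  using sublinear_add[of p x "- x"] sublinear_zero[of p] by simp

lemma sublinear_norm: "sublinear norm"
  by (rule sublinearI) (auto intro: norm_triangle_ineq)

text \<open>The largest sublinear functional below \<open>p\<close> that is at most \<open>- p y\<close> at \<open>- y\<close>: a linear
  functional below it has to agree with \<open>p\<close> at \<open>y\<close>.\<close>

definition tilt :: "('v::real_vector \<Rightarrow> real) \<Rightarrow> 'v \<Rightarrow> 'v \<Rightarrow> real"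
  where "tilt p y x = (INF t\<in>{0..}. p (x + t *\<^sub>R y) - t * p y)"

lemma tilt_le:
  assumes "sublinear p" "t \<ge> 0"
  shows "tilt p y x \<le> p (x + t *\<^sub>R y) - t * p y"
proof -
  have "- p (- x) \<le> p (x + s *\<^sub>R y) - s * p y" if "s \<ge> 0" for s
    using sublinear_add[OF assms(1), of "x + s *\<^sub>R y" "- x"]
      sublinear_scale[OF assms(1) that, of y] by simp
  then have "bdd_below ((\<lambda>t. p (x + t *\<^sub>R y) - t * p y) ` {0..})"
    by (auto intro!: bdd_belowI2)
  then show ?thesis
    unfolding tilt_def using assms(2) by (auto intro: cINF_lower)
qed

lemma tilt_ge:
  assumes "\<And>t. t \<ge> 0 \<Longrightarrow> c \<le> p (x + t *\<^sub>R y) - t * p y"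
  shows "c \<le> tilt p y x"
  unfolding tilt_def using assms by (auto intro!: cINF_greatest)

lemma sublinear_tilt:
  assumes p: "sublinear p"
  shows "sublinear (tilt p y)"
proof (rule sublinearI)
  fix x z
  have "tilt p y (x + z) - (p (x + s *\<^sub>R y) - s * p y) \<le> tilt p y z" if s: "s \<ge> 0" for s
  proof (rule tilt_ge)
    fix t :: real
    assume t: "t \<ge> 0"
    show "tilt p y (x + z) - (p (x + s *\<^sub>R y) - s * p y) \<le> p (z + t *\<^sub>R y) - t * p y"
      using tilt_le[OF p, of "s + t" y "x + z"] s t
        sublinear_add[OF p, of "x + s *\<^sub>R y" "z + t *\<^sub>R y"]
      by (simp add: algebra_simps)
  qed
  then have "tilt p y (x + z) - tilt p y z \<le> tilt p y x"
    by (intro tilt_ge) (simp add: algebra_simps)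
  then show "tilt p y (x + z) \<le> tilt p y x + tilt p y z"
    by simp
next
  fix t :: real and x
  assume t: "t \<ge> 0"
  have *: "tilt p y (t *\<^sub>R x) \<le> t * (p (x + s *\<^sub>R y) - s * p y)" if "s \<ge> 0" for s
    using tilt_le[OF p, of "t * s" y "t *\<^sub>R x"] t that
      sublinear_scale[OF p t, of "x + s *\<^sub>R y"]
    by (simp add: algebra_simps)
  show "tilt p y (t *\<^sub>R x) \<le> t * tilt p y x"
  proof (cases "t = 0")
    case True
    then show ?thesis
      using *[of 0] by simp
  next
    case False
    with t have "t > 0"
      by simp
    have "tilt p y (t *\<^sub>R x) / t \<le> tilt p y x"
      using * \<open>t > 0\<close> by (intro tilt_ge) (simp add: field_simps)
    then show ?thesis
      using \<open>t > 0\<close> by (simp add: field_simps)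
  qed
qed

text \<open>The common upper bound \<open>p\<close> keeps the infimum finite, since \<open>- p (- x) \<le> - q (- x) \<le> q x\<close>; the
  chain condition gives subadditivity, as any two members can be replaced by the smaller one.\<close>

lemma sublinear_INF_chain:
  fixes C :: "('v::real_vector \<Rightarrow> real) set"
  assumes sub: "\<And>q. q \<in> C \<Longrightarrow> sublinear q" and below: "\<And>q. q \<in> C \<Longrightarrow> q \<le> p"
    and "C \<noteq> {}" and chain: "\<And>q r. q \<in> C \<Longrightarrow> r \<in> C \<Longrightarrow> q \<le> r \<or> r \<le> q"
  defines "u \<equiv> \<lambda>x. INF q\<in>C. q x"
  shows "sublinear u" and "q \<in> C \<Longrightarrow> u \<le> q"
proof -
  have bdd: "bdd_below ((\<lambda>q. q x) ` C)" for x
  proof (rule bdd_belowI2)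
    fix q
    assume q: "q \<in> C"
    show "- p (- x) \<le> q x"
      using sublinear_ge[OF sub[OF q], of x] le_funD[OF below[OF q], of "- x"] by linarith
  qed
  have lower: "u x \<le> q x" if "q \<in> C" for q x
    unfolding u_def by (rule cINF_lower[OF bdd that])
  have greatest: "c \<le> u x" if "\<And>q. q \<in> C \<Longrightarrow> c \<le> q x" for c x
    unfolding u_def by (rule cINF_greatest[OF \<open>C \<noteq> {}\<close> that])
  show "u \<le> q" if "q \<in> C"
    using lower[OF that] by (rule le_funI)
  show "sublinear u"
  proof (rule sublinearI)
    fix x y
    have *: "u (x + y) \<le> q x + r y" if q: "q \<in> C" and r: "r \<in> C" for q r
    proof -
      obtain m where m: "m \<in> C" "m \<le> q" "m \<le> r"
        using chain[OF q r] q r by auto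
      show ?thesis
        using lower[OF m(1), of "x + y"] sublinear_add[OF sub[OF m(1)], of x y]
          le_funD[OF m(2), of x] le_funD[OF m(3), of y] by linarith
    qed
    have "u (x + y) - q x \<le> u y" if "q \<in> C" for q
      using *[OF that] by (intro greatest) (simp add: algebra_simps)
    then have "u (x + y) - u y \<le> u x"
      by (intro greatest) (simp add: algebra_simps)
    then show "u (x + y) \<le> u x + u y"
      by simp
  next
    fix t :: real and x
    assume t: "t \<ge> 0"
    have *: "u (t *\<^sub>R x) \<le> t * q x" if "q \<in> C" for q
      using lower[OF that, of "t *\<^sub>R x"] sublinear_scale[OF sub[OF that] t] by simp
    show "u (t *\<^sub>R x) \<le> t * u x"
    proof (cases "t = 0")
      case True
      then show ?thesis
        using * \<open>C \<noteq> {}\<close> by auto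
    next
      case False
      with t have "t > 0"
        by simp
      have "u (t *\<^sub>R x) / t \<le> u x"
        using * \<open>t > 0\<close> by (intro greatest) (simp add: field_simps)
      then show ?thesis
        using \<open>t > 0\<close> by (simp add: field_simps)
    qed
  qed
qed

lemma minimal_sublinear_exists:
  assumes p: "sublinear p"
  shows "\<exists>m. sublinear m \<and> m \<le> p \<and> (\<forall>q. sublinear q \<longrightarrow> q \<le> m \<longrightarrow> q = m)"
proof -
  define A where "A = {q. sublinear q \<and> q \<le> p}"
  have "\<exists>m\<in>A. \<forall>q\<in>A. q \<le> m \<longrightarrow> q = m"
  proof (rule predicate_Zorn)
    show "partial_order_on A (relation_of (\<lambda>q r. r \<le> q) A)"
      by (rule partial_order_on_relation_ofI) auto
  next
    fix C
    assume C: "C \<in> Chains (relation_of (\<lambda>q r. r \<le> q) A)"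
    then have CA: "C \<subseteq> A" and chain: "\<And>q r. q \<in> C \<Longrightarrow> r \<in> C \<Longrightarrow> q \<le> r \<or> r \<le> q"
      by (auto simp: Chains_def relation_of_def)
    show "\<exists>u\<in>A. \<forall>a\<in>C. u \<le> a"
    proof (cases "C = {}")
      case True
      then show ?thesis
        using p by (auto simp: A_def)
    next
      case False
      then obtain q where q: "q \<in> C"
        by auto
      define u where "u = (\<lambda>x. INF q\<in>C. q x)"
      have sub: "\<And>q. q \<in> C \<Longrightarrow> sublinear q" and below: "\<And>q. q \<in> C \<Longrightarrow> q \<le> p"
        using CA by (auto simp: A_def)
      have u: "sublinear u" "\<And>q. q \<in> C \<Longrightarrow> u \<le> q"
        using sublinear_INF_chain[OF sub below False chain] by (simp_all add: u_def)
      have "u \<in> A"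
        using u q below[OF q] by (auto simp: A_def intro: order_trans)
      then show ?thesis
        using u(2) by auto
    qed
  qed
  then show ?thesis
    unfolding A_def by (auto intro: order_trans)
qed

text \<open>By minimality \<open>tilt m y\<close> equals \<open>m\<close>, and its value at \<open>x\<close> is at most
  \<open>m (x + y) - m y\<close>: this is superadditivity.\<close>

lemma minimal_sublinear_linear:
  fixes m :: "'v::real_vector \<Rightarrow> real"
  assumes m: "sublinear m" and min: "\<And>q. sublinear q \<Longrightarrow> q \<le> m \<Longrightarrow> q = m"
  shows "linear m"
proof -
  have "tilt m y \<le> m" for y
    using tilt_le[OF m, of 0 y] by (auto intro!: le_funI)
  then have eq: "tilt m y = m" for y
    by (rule min[OF sublinear_tilt[OF m]])
  have add: "m (x + y) = m x + m y" for x y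
    using tilt_le[OF m, of 1 y x] sublinear_add[OF m, of x y] eq[of y] by simp
  have minus: "m (- x) = - m x" for x
    using add[of x "- x"] sublinear_zero[OF m] by simp
  have "m (t *\<^sub>R x) = t * m x" for t x
  proof (cases "t \<ge> 0")
    case True
    then show ?thesis
      by (rule sublinear_scale[OF m])
  next
    case False
    then show ?thesis
      using sublinear_scale[OF m, of "- t" x] minus[of "t *\<^sub>R x"] by simp
  qed
  then show ?thesis
    using add by (intro linearI) auto
qed

text \<open>A minimal sublinear functional below the norm tilted in direction \<open>v\<close> is linear, and the tilt
  forces the value \<open>norm v\<close> at \<open>v\<close>.\<close>

lemma norming_functional:
  fixes v :: "'v::real_normed_vector"
  shows "\<exists>l. linear l \<and> (\<forall>x. \<bar>l x\<bar> \<le> norm x) \<and> l v = norm v"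
proof -
  have sub: "sublinear (tilt norm v)"
    by (rule sublinear_tilt[OF sublinear_norm])
  obtain l where l: "sublinear l" "l \<le> tilt norm v" "\<And>q. sublinear q \<Longrightarrow> q \<le> l \<Longrightarrow> q = l"
    using minimal_sublinear_exists[OF sub] by blast
  have lin: "linear l"
    using l by (intro minimal_sublinear_linear)
  have le: "l x \<le> norm x" for x
    using le_funD[OF l(2), of x] tilt_le[OF sublinear_norm, of 0 v x] by simp
  have abs: "\<bar>l x\<bar> \<le> norm x" for x
    using le[of x] le[of "- x"] linear_neg[OF lin, of x] by simp
  have "l (- v) \<le> - norm v"
    using le_funD[OF l(2), of "- v"] tilt_le[OF sublinear_norm, of 1 v "- v"] by simp
  then have "l v = norm v"
    using linear_neg[OF lin, of v] le[of v] by simp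
  with lin abs show ?thesis
    by blast
qed

text \<open>The complexification \<open>x \<mapsto> l x - \<i> l (\<i> x)\<close> of a real norming functional. The bound
  \<open>2 * norm x\<close> is the cheap one; only its being universal matters below.\<close>

lemma norming_functional_complex:
  fixes v :: "'a::complex_banach_algebra_1"
  obtains L :: "'a \<Rightarrow> complex" where "linear L" "\<And>c x. L (c *\<^sub>C x) = c * L x"
    "\<And>x. norm (L x) \<le> 2 * norm x" "norm v \<le> norm (L v)"
proof -
  obtain l where l: "linear l" "\<And>x::'a. \<bar>l x\<bar> \<le> norm x" "l v = norm v"
    using norming_functional[of v] by blast
  define L where "L = (\<lambda>x. Complex (l x) (- l (\<i> *\<^sub>C x)))"
  have real: "r *\<^sub>R (c *\<^sub>C x) = (complex_of_real r * c) *\<^sub>C x" for r c and x :: 'a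
    by (metis scaleC_complex_of_real scaleC_scaleC)
  have decomp: "c *\<^sub>C x = Re c *\<^sub>R x + Im c *\<^sub>R (\<i> *\<^sub>C x)" for c and x :: 'a
  proof -
    have "c = complex_of_real (Re c) + complex_of_real (Im c) * \<i>"
      by (simp add: complex_eq_iff)
    then have "c *\<^sub>C x = (complex_of_real (Re c) + complex_of_real (Im c) * \<i>) *\<^sub>C x"
      by simp
    then show ?thesis
      by (simp only: scaleC_add_left real scaleC_complex_of_real)
  qed
  have lc: "l (c *\<^sub>C x) = Re c * l x + Im c * l (\<i> *\<^sub>C x)" for c x
    by (subst decomp) (simp add: linear_add[OF l(1)] linear_cmul[OF l(1)])
  show ?thesis
  proof (rule that[of L])
    show "linear L"
    proof (rule linearI)
      show "L (x + y) = L x + L y" for x y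
        by (simp add: L_def complex_eq_iff scaleC_add_right linear_add[OF l(1)])
      show "L (r *\<^sub>R x) = r *\<^sub>R L x" for r x
      proof -
        have "\<i> *\<^sub>C (r *\<^sub>R x) = r *\<^sub>R (\<i> *\<^sub>C x)"
          by (simp add: real flip: scaleC_complex_of_real) (simp add: scaleC_scaleC mult.commute)
        then show ?thesis
          by (simp add: L_def complex_eq_iff linear_cmul[OF l(1)])
      qed
    qed
    show "L (c *\<^sub>C x) = c * L x" for c x
      using lc[of c x] lc[of "\<i> * c" x]
      by (simp add: L_def complex_eq_iff scaleC_scaleC algebra_simps)
    show "norm (L x) \<le> 2 * norm x" for x
    proof -
      have "norm (L x) \<le> \<bar>l x\<bar> + \<bar>l (\<i> *\<^sub>C x)\<bar>"
        using cmod_le[of "L x"] by (simp add: L_def)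
      then show ?thesis
        using l(2)[of x] l(2)[of "\<i> *\<^sub>C x"] by (simp add: norm_scaleC)
    qed
    show "norm v \<le> norm (L v)"
      using abs_Re_le_cmod[of "L v"] l(3) by (simp add: L_def)
  qed
qed

section \<open>Cauchy estimates for Gateaux differentiable maps\<close>

text \<open>Discs of radius \<open>R / 3\<close> about points of the half-size disc stay inside the disc of radius
  \<open>R\<close>, so the Cauchy inequality bounds the first two derivatives by \<open>3 M / R\<close> and
  \<open>18 M / R\<^sup>2\<close>.\<close>

lemma bounded_holomorphic_taylor_bounds:
  fixes \<psi> :: "complex \<Rightarrow> complex"
  assumes hol: "\<psi> holomorphic_on ball 0 R" and M: "\<And>z. z \<in> ball 0 R \<Longrightarrow> norm (\<psi> z) \<le> M"
    and z: "norm z < R / 2"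
  shows "norm (\<psi> z - \<psi> 0) \<le> 3 * M / R * norm z"
    and "norm (\<psi> z - \<psi> 0 - deriv \<psi> 0 * z) \<le> 18 * M / R\<^sup>2 * (norm z)\<^sup>2"
proof -
  have R: "R > 0"
    using z norm_ge_zero[of z] by linarith
  let ?S = "ball (0::complex) (R / 2)"
  have sub: "cball w (R / 3) \<subseteq> ball 0 R" if "w \<in> ?S" for w
  proof
    fix y
    assume "y \<in> cball w (R / 3)"
    then show "y \<in> ball 0 R"
      using that R dist_triangle[of 0 y w] by simp
  qed
  have bd: "norm ((deriv ^^ n) \<psi> w) \<le> fact n * M / (R / 3) ^ n" if w: "w \<in> ?S" for n w
  proof (rule Cauchy_inequality)
    show "\<psi> holomorphic_on ball w (R / 3)"
      using holomorphic_on_subset[OF hol] sub[OF w] ball_subset_cball by blast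
    show "continuous_on (cball w (R / 3)) \<psi>"
      using holomorphic_on_imp_continuous_on[OF hol] sub[OF w] by (rule continuous_on_subset)
    show "norm (\<psi> x) \<le> M" if "norm (w - x) = R / 3" for x
      using sub[OF w] that by (intro M) (auto simp: dist_norm)
  qed (use R in simp)
  have der: "((deriv ^^ i) \<psi> has_field_derivative (deriv ^^ Suc i) \<psi> w) (at w within ?S)"
    if w: "w \<in> ?S" for i w
  proof -
    have "(deriv ^^ i) \<psi> holomorphic_on ball 0 R"
      by (rule holomorphic_higher_deriv[OF hol open_ball])
    then show ?thesis
      using w R
      by (auto intro!: DERIV_subset[OF holomorphic_derivI[of _ "ball 0 R"]])
  qed
  have "norm ((deriv ^^ 0) \<psi> z - (\<Sum>i\<le>0. (deriv ^^ i) \<psi> 0 * (z - 0) ^ i / fact i))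
      \<le> (3 * M / R) * norm (z - 0) ^ Suc 0 / fact 0"
  proof (rule field_Taylor)
    show "convex ?S"
      by (rule convex_ball)
    show "((deriv ^^ i) \<psi> has_field_derivative (deriv ^^ Suc i) \<psi> w) (at w within ?S)"
      if "w \<in> ?S" for i w
      using der[OF that] .
    show "norm ((deriv ^^ Suc 0) \<psi> w) \<le> 3 * M / R" if "w \<in> ?S" for w
      using bd[OF that, of 1] R by (simp add: field_simps)
  qed (use z R in auto)
  then show "norm (\<psi> z - \<psi> 0) \<le> 3 * M / R * norm z"
    by simp
  have "norm ((deriv ^^ 0) \<psi> z - (\<Sum>i\<le>1. (deriv ^^ i) \<psi> 0 * (z - 0) ^ i / fact i))
      \<le> (18 * M / R\<^sup>2) * norm (z - 0) ^ Suc 1 / fact 1"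
  proof (rule field_Taylor)
    show "convex ?S"
      by (rule convex_ball)
    show "((deriv ^^ i) \<psi> has_field_derivative (deriv ^^ Suc i) \<psi> w) (at w within ?S)"
      if "w \<in> ?S" for i w
      using der[OF that] .
    show "norm ((deriv ^^ Suc 1) \<psi> w) \<le> 18 * M / R\<^sup>2" if "w \<in> ?S" for w
      using bd[OF that, of 2] R by (simp add: field_simps power2_eq_square numeral_2_eq_2)
  qed (use z R in auto)
  then show "norm (\<psi> z - \<psi> 0 - deriv \<psi> 0 * z) \<le> 18 * M / R\<^sup>2 * (norm z)\<^sup>2"
    by (simp add: power2_eq_square algebra_simps)
qed

lemma scaleC_minus_right: "c *\<^sub>C (- x) = - (c *\<^sub>C x)"
  by (metis add_cancel_right_left add_eq_0_iff scaleC_add_right right_minus)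

lemma scaleC_diff_right: "c *\<^sub>C (x - y) = c *\<^sub>C x - c *\<^sub>C y"
  using scaleC_add_right[of c x "- y"] by (simp add: scaleC_minus_right)

lemma scaleC_zero_left [simp]: "0 *\<^sub>C x = (0 :: 'a::complex_banach_algebra_1)"
  using scaleC_complex_of_real[of 0 x] by simp

lemma scaleC_one [simp]: "1 *\<^sub>C x = (x :: 'a::complex_banach_algebra_1)"
  using scaleC_complex_of_real[of 1 x] by simp

lemma scaleC_scaleR: "c *\<^sub>C (r *\<^sub>R x) = r *\<^sub>R (c *\<^sub>C x)"
  by (metis mult.commute scaleC_complex_of_real scaleC_scaleC)

lemma gateaux_line_holomorphic:
  fixes G :: "'a::complex_banach_algebra_1 \<Rightarrow> 'a"
  assumes gat: "\<And>z. z \<in> U \<Longrightarrow> gateaux_differentiable_at G (x + z *\<^sub>C k)"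
    and L: "linear L" "\<And>c x. L (c *\<^sub>C x) = c * L x" "\<And>x. norm (L x) \<le> B * norm x"
  shows "(\<lambda>z. L (G (x + z *\<^sub>C k)) :: complex) holomorphic_on U"
  unfolding holomorphic_on_def
proof (intro ballI)
  fix w
  assume "w \<in> U"
  let ?b = "x + w *\<^sub>C k"
  obtain D where "((\<lambda>z. inverse z *\<^sub>C (G (?b + z *\<^sub>C k) - G ?b)) \<longlongrightarrow> D) (at 0)"
    using gat[OF \<open>w \<in> U\<close>] unfolding gateaux_differentiable_at_def by blast
  moreover have "bounded_linear L"
    using L(1,3) by (intro bounded_linear_intro[of _ B])
      (auto simp: linear_add linear_cmul mult.commute)
  ultimately have "((\<lambda>z. L (inverse z *\<^sub>C (G (?b + z *\<^sub>C k) - G ?b))) \<longlongrightarrow> L D) (at 0)"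
    by (rule bounded_linear.tendsto[rotated])
  then have "((\<lambda>z. (L (G (x + (w + z) *\<^sub>C k)) - L (G ?b)) / z) \<longlongrightarrow> L D) (at 0)"
    by (simp add: L(2) linear_diff[OF L(1)] scaleC_add_left add.assoc divide_inverse mult.commute)
  then have "((\<lambda>z. L (G (x + z *\<^sub>C k))) has_field_derivative L D) (at w)"
    by (simp add: DERIV_def)
  then show "(\<lambda>z. L (G (x + z *\<^sub>C k))) field_differentiable at w within U"
    unfolding field_differentiable_def by (meson DERIV_subset subset_UNIV)
qed

text \<open>The scalar Taylor bounds, applied to a functional norming the vector to be estimated. In the
  second estimate both difference quotients are compared with the derivative of the scalar function
  at \<open>0\<close>; this number depends on the functional, but it cancels. No vector-valued
  derivative appears, so the estimate can be passed to pointwise limits of \<open>G\<close>.\<close>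

lemma gateaux_cauchy_estimates:
  fixes G :: "'a::complex_banach_algebra_1 \<Rightarrow> 'a"
  assumes gat: "\<And>z. z \<in> ball 0 R \<Longrightarrow> gateaux_differentiable_at G (x + z *\<^sub>C k)"
    and M: "\<And>z. z \<in> ball 0 R \<Longrightarrow> norm (G (x + z *\<^sub>C k)) \<le> M"
    and z: "norm z < R / 2"
  shows "norm (G (x + z *\<^sub>C k) - G x) \<le> 6 * M / R * norm z"
    and "norm w < R / 2 \<Longrightarrow> z \<noteq> 0 \<Longrightarrow> w \<noteq> 0 \<Longrightarrow>
      norm (inverse z *\<^sub>C (G (x + z *\<^sub>C k) - G x) - inverse w *\<^sub>C (G (x + w *\<^sub>C k) - G x))
        \<le> 36 * M / R\<^sup>2 * (norm z + norm w)"
proof -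
  have taylor: "norm (L (G (x + u *\<^sub>C k)) - L (G x)) \<le> 3 * (2 * M) / R * norm u"
      "norm (L (G (x + u *\<^sub>C k)) - L (G x) - deriv (\<lambda>z. L (G (x + z *\<^sub>C k))) 0 * u)
        \<le> 18 * (2 * M) / R\<^sup>2 * (norm u)\<^sup>2"
    if L: "linear L" "\<And>c x. L (c *\<^sub>C x) = c * L x" "\<And>x. norm (L x) \<le> 2 * norm x"
      and u: "norm u < R / 2" for L :: "'a \<Rightarrow> complex" and u
  proof -
    have hol: "(\<lambda>z. L (G (x + z *\<^sub>C k))) holomorphic_on ball 0 R"
      using gat L by (rule gateaux_line_holomorphic)
    have bd: "norm (L (G (x + z *\<^sub>C k))) \<le> 2 * M" if "z \<in> ball 0 R" for z
      using L(3)[of "G (x + z *\<^sub>C k)"] M[OF that] by linarith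
    show "norm (L (G (x + u *\<^sub>C k)) - L (G x)) \<le> 3 * (2 * M) / R * norm u"
      using bounded_holomorphic_taylor_bounds(1)[OF hol bd u] by simp
    show "norm (L (G (x + u *\<^sub>C k)) - L (G x) - deriv (\<lambda>z. L (G (x + z *\<^sub>C k))) 0 * u)
        \<le> 18 * (2 * M) / R\<^sup>2 * (norm u)\<^sup>2"
      using bounded_holomorphic_taylor_bounds(2)[OF hol bd u] by simp
  qed
  obtain L :: "'a \<Rightarrow> complex" where L: "linear L" "\<And>c x. L (c *\<^sub>C x) = c * L x"
    "\<And>x. norm (L x) \<le> 2 * norm x"
    "norm (G (x + z *\<^sub>C k) - G x) \<le> norm (L (G (x + z *\<^sub>C k) - G x))"
    by (rule norming_functional_complex[of "G (x + z *\<^sub>C k) - G x"]) blast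
  show "norm (G (x + z *\<^sub>C k) - G x) \<le> 6 * M / R * norm z"
    using L(4) taylor(1)[OF L(1-3) z] by (simp add: linear_diff[OF L(1)])
  assume w: "norm w < R / 2" and nz: "z \<noteq> 0" "w \<noteq> 0"
  let ?q = "\<lambda>z. inverse z *\<^sub>C (G (x + z *\<^sub>C k) - G x)"
  obtain L :: "'a \<Rightarrow> complex" where L: "linear L" "\<And>c x. L (c *\<^sub>C x) = c * L x"
    "\<And>x. norm (L x) \<le> 2 * norm x" "norm (?q z - ?q w) \<le> norm (L (?q z - ?q w))"
    by (rule norming_functional_complex[of "?q z - ?q w"]) blast
  define d where "d = deriv (\<lambda>z. L (G (x + z *\<^sub>C k))) 0"
  have q: "norm (L (?q u) - d) \<le> 36 * M / R\<^sup>2 * norm u" if u: "norm u < R / 2" "u \<noteq> 0" for u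
  proof -
    have "L (?q u) - d = (L (G (x + u *\<^sub>C k)) - L (G x) - d * u) / u"
      using u(2) by (simp add: L(2) linear_diff[OF L(1)] field_simps)
    then have "norm (L (?q u) - d) = norm (L (G (x + u *\<^sub>C k)) - L (G x) - d * u) / norm u"
      by (simp add: norm_divide)
    also have "\<dots> \<le> (18 * (2 * M) / R\<^sup>2 * (norm u)\<^sup>2) / norm u"
      using taylor(2)[OF L(1-3) u(1)] by (intro divide_right_mono) (auto simp: d_def)
    finally show ?thesis
      using u(2) by (simp add: power2_eq_square)
  qed
  have "norm (?q z - ?q w) \<le> norm ((L (?q z) - d) - (L (?q w) - d))"
    using L(4) by (simp add: linear_diff[OF L(1)])
  also have "\<dots> \<le> norm (L (?q z) - d) + norm (L (?q w) - d)"
    by (rule norm_triangle_ineq4)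
  also have "\<dots> \<le> 36 * M / R\<^sup>2 * (norm z + norm w)"
    using q[OF z nz(1)] q[OF w nz(2)] by (simp add: distrib_left)
  finally show "norm (?q z - ?q w) \<le> 36 * M / R\<^sup>2 * (norm z + norm w)" .
qed

text \<open>On the complex line through \<open>x\<close> and \<open>y\<close>, with parameter \<open>0\<close> at \<open>x\<close> and \<open>1\<close> at \<open>y\<close>, the map is
  bounded on a disc of radius inversely proportional to \<open>norm (y - x)\<close>, so the Cauchy estimate at
  parameter \<open>1\<close> is linear in \<open>norm (y - x)\<close>.\<close>

lemma bounded_gateaux_lipschitz:
  fixes G :: "'a::complex_banach_algebra_1 \<Rightarrow> 'a"
  assumes gat: "\<And>b. b \<in> ball c \<delta> \<Longrightarrow> gateaux_differentiable_at G b"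
    and M: "\<And>b. b \<in> ball c \<delta> \<Longrightarrow> norm (G b) \<le> M"
    and x: "x \<in> ball c (\<delta> / 8)" and y: "y \<in> ball c (\<delta> / 8)"
  shows "norm (G y - G x) \<le> 12 * M / \<delta> * norm (y - x)"
proof (cases "y = x")
  case False
  define k where "k = y - x"
  define R where "R = \<delta> / (2 * norm k)"
  have k: "norm k > 0"
    using False by (simp add: k_def)
  have "norm k < \<delta> / 4"
    using x y dist_triangle[of y x c] by (simp add: k_def dist_norm norm_minus_commute)
  then have R: "norm (1::complex) < R / 2"
    using k by (simp add: R_def field_simps)
  have mem: "x + z *\<^sub>C k \<in> ball c \<delta>" if "z \<in> ball 0 R" for z
  proof -
    have "norm (z *\<^sub>C k) < \<delta> / 2"
      using that k by (simp add: R_def norm_scaleC field_simps)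
    moreover have "norm (c - x) < \<delta> / 8"
      using x by (simp add: dist_norm)
    moreover have "0 \<le> norm (c - x)"
      by simp
    ultimately show ?thesis
      using norm_triangle_ineq4[of "c - x" "z *\<^sub>C k"]
      by (simp only: mem_ball dist_norm diff_diff_eq)
  qed
  have "norm (G (x + 1 *\<^sub>C k) - G x) \<le> 6 * M / R * norm (1::complex)"
    using gateaux_cauchy_estimates(1)[of R G x k M 1] gat M mem R by blast
  then show ?thesis
    by (simp add: R_def) (simp add: k_def)
qed simp

lemma Cauchy_tendsto:
  fixes q :: "'b \<Rightarrow> 'a::{complete_space}"
  assumes "\<And>e. e > 0 \<Longrightarrow> \<exists>P. eventually P F \<and> (\<forall>x y. P x \<and> P y \<longrightarrow> dist (q x) (q y) < e)"
    and "F \<noteq> bot"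
  shows "\<exists>D. (q \<longlongrightarrow> D) F"
proof -
  have "cauchy_filter (filtermap q F)"
    unfolding cauchy_filter_metric_filtermap using assms(1) by blast
  moreover have "filtermap q F \<noteq> bot"
    using assms(2) by (simp add: filtermap_bot_iff)
  moreover have "\<forall>F :: 'a filter. F \<noteq> bot \<longrightarrow> cauchy_filter F \<longrightarrow> (\<exists>D. F \<le> nhds D)"
    using complete_uniform[of "UNIV :: 'a set"] complete_UNIV by auto
  ultimately obtain D where "filtermap q F \<le> nhds D"
    by blast
  then show ?thesis
    unfolding filterlim_def by blast
qed

text \<open>The Cauchy estimate for difference quotients is uniform over the family, so it holds for the
  limit \<open>F\<close>, where it says that the quotients form a Cauchy filter at \<open>0\<close>.\<close>

lemma bounded_gateaux_limit:
  fixes G :: "real \<Rightarrow> 'a::complex_banach_algebra_1 \<Rightarrow> 'a"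
  assumes "\<rho> > 0" "\<tau> > 0"
    and gat: "\<And>h b. 0 < h \<Longrightarrow> h < \<tau> \<Longrightarrow> b \<in> ball c \<rho> \<Longrightarrow> gateaux_differentiable_at (G h) b"
    and M: "\<And>h b. 0 < h \<Longrightarrow> h < \<tau> \<Longrightarrow> b \<in> ball c \<rho> \<Longrightarrow> norm (G h b) \<le> M"
    and lim: "\<And>b. b \<in> ball c \<rho> \<Longrightarrow> ((\<lambda>h. G h b) \<longlongrightarrow> F b) (at_right 0)"
  shows "gateaux_differentiable_at F c"
  unfolding gateaux_differentiable_at_def
proof
  fix k :: 'a
  define R where "R = \<rho> / (norm k + 1)"
  have R: "R > 0"
    using \<open>\<rho> > 0\<close> by (simp add: R_def add_nonneg_pos)
  have mem: "c + z *\<^sub>C k \<in> ball c \<rho>" if "norm z < R" for z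
  proof -
    have "norm z * norm k \<le> norm z * (norm k + 1)"
      by (intro mult_left_mono) auto
    also have "\<dots> < \<rho>"
      using that by (simp add: R_def pos_less_divide_eq add_nonneg_pos)
    finally show ?thesis
      by (simp add: dist_norm norm_scaleC)
  qed
  define q where "q = (\<lambda>z. inverse z *\<^sub>C (F (c + z *\<^sub>C k) - F c))"
  have est: "norm (q z - q w) \<le> 36 * M / R\<^sup>2 * (norm z + norm w)"
    if z: "norm z < R / 2" "z \<noteq> 0" and w: "norm w < R / 2" "w \<noteq> 0" for z w
  proof (rule tendsto_upperbound)
    let ?q = "\<lambda>h z. inverse z *\<^sub>C (G h (c + z *\<^sub>C k) - G h c)"
    have bl: "bounded_linear (\<lambda>x::'a. u *\<^sub>C x)" for u
      by (intro bounded_linear_intro[of _ "norm u"])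
        (auto simp: scaleC_add_right scaleC_scaleR norm_scaleC)
    have limq: "((\<lambda>h. ?q h u) \<longlongrightarrow> q u) (at_right 0)" if "norm u < R" for u
      unfolding q_def using \<open>\<rho> > 0\<close>
      by (intro bounded_linear.tendsto[OF bl] tendsto_diff lim mem that) auto
    show "((\<lambda>h. norm (?q h z - ?q h w)) \<longlongrightarrow> norm (q z - q w)) (at_right 0)"
      using z w R by (intro tendsto_norm tendsto_diff limq) auto
    have "eventually (\<lambda>h. 0 < h \<and> h < \<tau>) (at_right 0)"
      using \<open>\<tau> > 0\<close> by (auto simp: eventually_at_right_field)
    then show "eventually (\<lambda>h. norm (?q h z - ?q h w) \<le> 36 * M / R\<^sup>2 * (norm z + norm w))
        (at_right 0)"
    proof eventually_elim
      case (elim h)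
      show ?case
        using elim mem z w by (intro gateaux_cauchy_estimates(2) gat M) auto
    qed
  qed simp
  have "norm (G (\<tau> / 2) c) \<le> M"
    using M[of "\<tau> / 2" c] \<open>\<tau> > 0\<close> \<open>\<rho> > 0\<close> by simp
  then have "M \<ge> 0"
    using norm_ge_zero order_trans by blast
  define K where "K = 36 * M / R\<^sup>2 + 1"
  have "K > 0"
    using \<open>M \<ge> 0\<close> by (simp add: K_def add_nonneg_pos)
  have estK: "norm (q z - q w) \<le> K * (norm z + norm w)"
    if "norm z < R / 2" "z \<noteq> 0" "norm w < R / 2" "w \<noteq> 0" for z w
  proof -
    have "36 * M / R\<^sup>2 * (norm z + norm w) \<le> K * (norm z + norm w)"
      unfolding K_def by (intro mult_right_mono) auto
    then show ?thesis
      using est[OF that] by linarith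
  qed
  have "\<exists>D. (q \<longlongrightarrow> D) (at 0)"
  proof (rule Cauchy_tendsto)
    fix e :: real
    assume "e > 0"
    let ?P = "\<lambda>z::complex. z \<noteq> 0 \<and> norm z < min (R / 2) (e / (2 * K))"
    have "min (R / 2) (e / (2 * K)) > 0"
      using \<open>e > 0\<close> \<open>K > 0\<close> R by simp
    then have "eventually ?P (at 0)"
      unfolding eventually_at by (intro exI[of _ "min (R / 2) (e / (2 * K))"]) simp
    moreover have "dist (q z) (q w) < e" if "?P z" "?P w" for z w
    proof -
      have "K * (norm z + norm w) < e"
        using that \<open>K > 0\<close> by (simp add: field_simps)
      then show ?thesis
        using estK[of z w] that by (simp add: dist_norm)
    qed
    ultimately show "\<exists>P. eventually P (at 0) \<and> (\<forall>z w. P z \<and> P w \<longrightarrow> dist (q z) (q w) < e)"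
      by blast
  qed simp
  then show "\<exists>D. ((\<lambda>z. inverse z *\<^sub>C (F (c + z *\<^sub>C k) - F c)) \<longlongrightarrow> D) (at 0)"
    unfolding q_def .
qed

lemma gateaux_differentiable_displacement:
  assumes "gateaux_differentiable_at F b"
  shows "gateaux_differentiable_at (\<lambda>b. r *\<^sub>R (F b - b)) b"
  unfolding gateaux_differentiable_at_def
proof
  fix k
  obtain D where D: "((\<lambda>z. inverse z *\<^sub>C (F (b + z *\<^sub>C k) - F b)) \<longlongrightarrow> D) (at 0)"
    using assms unfolding gateaux_differentiable_at_def by blast
  have eq: "r *\<^sub>R (inverse z *\<^sub>C (F (b + z *\<^sub>C k) - F b)) - r *\<^sub>R k
      = inverse z *\<^sub>C (r *\<^sub>R (F (b + z *\<^sub>C k) - (b + z *\<^sub>C k)) - r *\<^sub>R (F b - b))" if "z \<noteq> 0" for z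
    using that
    by (simp add: scaleC_diff_right scaleC_add_right scaleC_scaleR scaleC_scaleC algebra_simps)
  have "((\<lambda>z. r *\<^sub>R (inverse z *\<^sub>C (F (b + z *\<^sub>C k) - F b)) - r *\<^sub>R k) \<longlongrightarrow> r *\<^sub>R D - r *\<^sub>R k)
      (at 0)"
    by (intro tendsto_intros D)
  then have "((\<lambda>z. inverse z *\<^sub>C (r *\<^sub>R (F (b + z *\<^sub>C k) - (b + z *\<^sub>C k)) - r *\<^sub>R (F b - b)))
      \<longlongrightarrow> r *\<^sub>R D - r *\<^sub>R k) (at 0)"
    by (rule Lim_transform_eventually) (auto simp: eventually_at eq intro!: exI[of _ 1])
  then show "\<exists>D. ((\<lambda>z. inverse z *\<^sub>C (r *\<^sub>R (F (b + z *\<^sub>C k) - (b + z *\<^sub>C k)) - r *\<^sub>R (F b - b)))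
      \<longlongrightarrow> D) (at 0)"
    by blast
qed

section \<open>Small-time behaviour of the semigroup\<close>

locale analytic_semigroup =
  fixes \<Omega> :: "'a::complex_banach_algebra_1 set"
    and f :: "real \<Rightarrow> 'a \<Rightarrow> 'a"
  assumes open_domain: "open \<Omega>"
    and semigroup: "composition_semigroup_on \<Omega> f"
    and analytic: "\<And>t. t \<ge> 0 \<Longrightarrow> banach_analytic_on \<Omega> (f t)"
    and local_uniformity: "\<And>b'. b' \<in> \<Omega> \<Longrightarrow> \<exists>\<delta>>0.
      uniform_limit (ball b' \<delta> \<inter> \<Omega>) (\<lambda>t b. f t b - b) (\<lambda>b. 0) (at_right 0) \<and>
      (\<forall>T>0. bounded ((\<lambda>(t, b). f t b - b) ` ({0..T} \<times> (ball b' \<delta> \<inter> \<Omega>))))"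
begin

abbreviation displacement :: "real \<Rightarrow> 'a \<Rightarrow> 'a"
  where "displacement t b \<equiv> f t b - b"

lemma f_mem: "t \<ge> 0 \<Longrightarrow> b \<in> \<Omega> \<Longrightarrow> f t b \<in> \<Omega>"
  using semigroup by (auto simp: composition_semigroup_on_def)

lemma f_zero: "b \<in> \<Omega> \<Longrightarrow> f 0 b = b"
  using semigroup by (auto simp: composition_semigroup_on_def)

lemma f_add: "s \<ge> 0 \<Longrightarrow> t \<ge> 0 \<Longrightarrow> b \<in> \<Omega> \<Longrightarrow> f (s + t) b = f s (f t b)"
  using semigroup by (auto simp: composition_semigroup_on_def)

lemma gateaux_displacement:
  "t \<ge> 0 \<Longrightarrow> b \<in> \<Omega> \<Longrightarrow> gateaux_differentiable_at (\<lambda>b. r *\<^sub>R displacement t b) b"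
  using analytic by (auto simp: banach_analytic_on_def intro: gateaux_differentiable_displacement)

lemma displacement_lipschitz:
  assumes sub: "ball c \<delta> \<subseteq> \<Omega>" and t: "t \<ge> 0"
    and M: "\<And>b. b \<in> ball c \<delta> \<Longrightarrow> norm (displacement t b) \<le> M"
    and "x \<in> ball c (\<delta> / 8)" "y \<in> ball c (\<delta> / 8)"
  shows "norm (displacement t y - displacement t x) \<le> 12 * M / \<delta> * norm (y - x)"
proof (rule bounded_gateaux_lipschitz)
  show "gateaux_differentiable_at (\<lambda>b. displacement t b) b" if "b \<in> ball c \<delta>" for b
    using gateaux_displacement[of t b 1] that sub t by auto
qed (use assms in auto)

lemma local_ball:
  assumes "c \<in> \<Omega>"
  obtains \<delta> where "\<delta> > 0" "ball c \<delta> \<subseteq> \<Omega>"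
    "\<And>e. e > 0 \<Longrightarrow> \<exists>\<tau>>0. \<forall>t b. 0 \<le> t \<longrightarrow> t < \<tau> \<longrightarrow> b \<in> ball c \<delta> \<longrightarrow> norm (displacement t b) \<le> e"
    "\<And>T. \<exists>M. \<forall>t b. 0 \<le> t \<longrightarrow> t \<le> T \<longrightarrow> b \<in> ball c \<delta> \<longrightarrow> norm (displacement t b) \<le> M"
proof -
  obtain \<delta>1 where \<delta>1: "\<delta>1 > 0"
    "uniform_limit (ball c \<delta>1 \<inter> \<Omega>) (\<lambda>t b. f t b - b) (\<lambda>b. 0) (at_right 0)"
    "\<And>T. T > 0 \<Longrightarrow> bounded ((\<lambda>(t, b). f t b - b) ` ({0..T} \<times> (ball c \<delta>1 \<inter> \<Omega>)))"
    using local_uniformity[OF assms] by blast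
  obtain \<delta>2 where \<delta>2: "\<delta>2 > 0" "ball c \<delta>2 \<subseteq> \<Omega>"
    using open_domain assms openE by blast
  let ?\<delta> = "min \<delta>1 \<delta>2"
  have sub: "ball c ?\<delta> \<subseteq> ball c \<delta>1 \<inter> \<Omega>"
    using \<delta>2(2) by auto
  show ?thesis
  proof (rule that[of ?\<delta>])
    fix e :: real
    assume e: "e > 0"
    obtain \<tau> where \<tau>: "\<tau> > 0"
      "\<And>t b. 0 < t \<Longrightarrow> t < \<tau> \<Longrightarrow> b \<in> ball c \<delta>1 \<inter> \<Omega> \<Longrightarrow> norm (displacement t b) < e"
      using uniform_limitD[OF \<delta>1(2) e] by (auto simp: eventually_at_right_field)
    have "norm (displacement t b) \<le> e" if "0 \<le> t" "t < \<tau>" "b \<in> ball c ?\<delta>" for t b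
    proof (cases "t = 0")
      case True
      then show ?thesis
        using f_zero[of b] that sub e by auto
    next
      case False
      then show ?thesis
        using \<tau>(2)[of t b] that sub by fastforce
    qed
    then show "\<exists>\<tau>>0. \<forall>t b. 0 \<le> t \<longrightarrow> t < \<tau> \<longrightarrow> b \<in> ball c ?\<delta> \<longrightarrow> norm (displacement t b) \<le> e"
      using \<tau>(1) by blast
  next
    fix T :: real
    have "bounded ((\<lambda>(t, b). f t b - b) ` ({0..max T 1} \<times> (ball c \<delta>1 \<inter> \<Omega>)))"
      by (rule \<delta>1(3)) simp
    then obtain M where "\<And>v. v \<in> (\<lambda>(t, b). f t b - b) ` ({0..max T 1} \<times> (ball c \<delta>1 \<inter> \<Omega>))
        \<Longrightarrow> norm v \<le> M"
      unfolding bounded_iff by blast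
    then have "norm (displacement t b) \<le> M" if "0 \<le> t" "t \<le> T" "b \<in> ball c ?\<delta>" for t b
      using that sub by (force simp: image_iff)
    then show "\<exists>M. \<forall>t b. 0 \<le> t \<longrightarrow> t \<le> T \<longrightarrow> b \<in> ball c ?\<delta> \<longrightarrow> norm (displacement t b) \<le> M"
      by blast
  qed (use \<delta>1 \<delta>2 in auto)
qed

text \<open>The increment of the orbit over the step from \<open>k h\<close> to \<open>(k + 1) h\<close> is
  \<open>f (k h) (f h b) - f (k h) b\<close>, which differs from \<open>displacement h b\<close> by exactly the quantity
  assumed small. Reading the step this way, rather than as \<open>displacement h\<close> at the moving point
  \<open>f (k h) b\<close>, makes the error relative to \<open>displacement h b\<close> itself.\<close>

lemma displacement_iterate:
  assumes b: "b \<in> \<Omega>" and h: "h \<ge> 0"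
    and lip: "\<And>k. k < n \<Longrightarrow> norm (displacement (real k * h) (f h b) - displacement (real k * h) b)
      \<le> \<epsilon> * norm (displacement h b)"
  shows "norm (displacement (real n * h) b - real n *\<^sub>R displacement h b)
    \<le> real n * \<epsilon> * norm (displacement h b)"
  using lip
proof (induction n)
  case 0
  then show ?case
    using f_zero[OF b] by simp
next
  case (Suc n)
  let ?d = "displacement (real n * h) (f h b) - displacement (real n * h) b"
  have "f (real (Suc n) * h) b = f (real n * h) (f h b)"
    using f_add[of "real n * h" h b] h b by (simp add: distrib_right add.commute)
  then have "displacement (real (Suc n) * h) b - real (Suc n) *\<^sub>R displacement h b
      = (displacement (real n * h) b - real n *\<^sub>R displacement h b) + ?d"
    by (simp add: algebra_simps)
  then have "norm (displacement (real (Suc n) * h) b - real (Suc n) *\<^sub>R displacement h b)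
      \<le> norm (displacement (real n * h) b - real n *\<^sub>R displacement h b) + norm ?d"
    by (simp only: norm_triangle_ineq)
  also have "\<dots> \<le> real n * \<epsilon> * norm (displacement h b) + \<epsilon> * norm (displacement h b)"
    using Suc.prems by (intro add_mono Suc.IH) auto
  finally show ?case
    by (simp add: algebra_simps)
qed

text \<open>Once the Lipschitz constant of the displacements is at most \<open>1/2\<close>, iterating a step \<open>h\<close>
  keeps at least half of the linear growth: \<open>n / 2 * norm (displacement h b)\<close> is at most
  \<open>norm (displacement (n h) b)\<close>. The latter is bounded as long as \<open>n h\<close> is below a fixed time, and
  taking \<open>n\<close> of order \<open>1 / h\<close> gives the bound.\<close>

lemma displacement_linear_bound:
  assumes "c \<in> \<Omega>"
  obtains \<rho> \<tau> C where "\<rho> > 0" "\<tau> > 0" "C > 0" "ball c \<rho> \<subseteq> \<Omega>"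
    "\<And>t b. 0 \<le> t \<Longrightarrow> t < \<tau> \<Longrightarrow> b \<in> ball c \<rho> \<Longrightarrow> norm (displacement t b) \<le> C * t"
proof -
  obtain \<delta> where \<delta>: "\<delta> > 0" "ball c \<delta> \<subseteq> \<Omega>"
    "\<And>e. e > 0 \<Longrightarrow> \<exists>\<tau>>0. \<forall>t b. 0 \<le> t \<longrightarrow> t < \<tau> \<longrightarrow> b \<in> ball c \<delta> \<longrightarrow> norm (displacement t b) \<le> e"
    by (rule local_ball[OF assms]) blast
  \<comment> \<open>With the bound \<open>\<delta> / 24\<close> the Lipschitz constant \<open>12 * (\<delta> / 24) / \<delta>\<close> is \<open>1 / 2\<close>, and points of
    the ball of radius \<open>\<delta> / 16\<close> are moved within the ball of radius \<open>\<delta> / 8\<close>.\<close>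
  have "\<delta> / 24 > 0"
    using \<delta>(1) by simp
  then obtain \<tau> where \<tau>: "\<tau> > 0"
    "\<And>t b. 0 \<le> t \<Longrightarrow> t < \<tau> \<Longrightarrow> b \<in> ball c \<delta> \<Longrightarrow> norm (displacement t b) \<le> \<delta> / 24"
    using \<delta>(3) by blast
  define \<rho> where "\<rho> = \<delta> / 16"
  have bound: "norm (displacement h b) \<le> (\<delta> / 3 / \<tau>) * h"
    if h: "0 \<le> h" "h < \<tau> / 2" and b: "b \<in> ball c \<rho>" for h b
  proof (cases "h = 0")
    case True
    moreover have "b \<in> \<Omega>"
      using b \<delta>(1,2) by (auto simp: \<rho>_def)
    ultimately show ?thesis
      using f_zero by simp
  next
    case False
    with h have "h > 0"
      by simp
    have b': "b \<in> ball c \<delta>" "b \<in> ball c (\<delta> / 8)" "b \<in> \<Omega>"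
      using b \<delta>(1,2) by (auto simp: \<rho>_def)
    have "norm (displacement h b) \<le> \<delta> / 24"
      using \<tau> h b' by simp
    then have fb: "f h b \<in> ball c (\<delta> / 8)"
      using b \<delta>(1) norm_triangle_ineq4[of "c - b" "displacement h b"]
      by (simp add: \<rho>_def dist_norm)
    define n where "n = nat \<lfloor>\<tau> / (2 * h)\<rfloor>"
    have ratio: "1 \<le> \<tau> / (2 * h)"
      using h \<open>h > 0\<close> by (simp add: field_simps)
    then have "\<lfloor>\<tau> / (2 * h)\<rfloor> \<ge> 1"
      by (simp only: one_le_floor)
    then have n: "real n \<le> \<tau> / (2 * h)" "\<tau> / (2 * h) < real n + 1" "real n \<ge> 1"
      unfolding n_def by linarith+
    have "h \<le> real n * h"
      using mult_right_mono[OF n(3) h(1)] by (simp only: mult_1)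
    moreover have "real n * h \<le> \<tau> / 2" "\<tau> \<le> 2 * h + 2 * (real n * h)"
      using n(1,2) \<open>h > 0\<close> by (simp_all add: field_simps)
    ultimately have nh: "real n * h \<le> \<tau> / 2" "\<tau> \<le> 4 * (real n * h)"
      by linarith+
    have "norm (displacement (real n * h) b - real n *\<^sub>R displacement h b)
        \<le> real n * (1 / 2) * norm (displacement h b)"
    proof (rule displacement_iterate)
      fix k
      assume "k < n"
      then have kn: "real k * h \<le> real n * h"
        using h by (intro mult_right_mono) auto
      have k: "0 \<le> real k * h" "real k * h < \<tau>"
        using h order_trans[OF kn nh(1)] \<tau>(1) by simp_all
      have "norm (displacement (real k * h) (f h b) - displacement (real k * h) b)
          \<le> 12 * (\<delta> / 24) / \<delta> * norm (f h b - b)"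
        using \<delta>(2) k(1) \<tau>(2)[OF k] b'(2) fb by (rule displacement_lipschitz)
      then show "norm (displacement (real k * h) (f h b) - displacement (real k * h) b)
          \<le> 1 / 2 * norm (displacement h b)"
        using \<delta>(1) by simp
    qed (use b' h in auto)
    moreover have "norm (displacement (real n * h) b) \<le> \<delta> / 24"
      using \<tau> nh h b' by simp
    moreover have "norm (real n *\<^sub>R displacement h b)
        \<le> norm (displacement (real n * h) b)
          + norm (displacement (real n * h) b - real n *\<^sub>R displacement h b)"
      by (metis norm_minus_commute norm_triangle_sub)
    ultimately have "real n * norm (displacement h b) \<le> \<delta> / 12"
      by simp
    then have "h * (real n * norm (displacement h b)) \<le> h * (\<delta> / 12)"
      using h by (intro mult_left_mono)
    moreover have "\<tau> * norm (displacement h b) \<le> 4 * (real n * h) * norm (displacement h b)"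
      using nh by (intro mult_right_mono) auto
    ultimately show ?thesis
      using \<tau>(1) by (simp add: field_simps)
  qed
  show ?thesis
    by (rule that[of \<rho> "\<tau> / 2" "\<delta> / 3 / \<tau>"])
      (use \<delta> \<tau>(1) bound in \<open>auto simp: \<rho>_def\<close>)
qed

lemma displacement_local_estimates:
  assumes "c \<in> \<Omega>"
  obtains \<rho> \<tau> C K where "\<rho> > 0" "\<tau> > 0" "C > 0" "K > 0" "ball c \<rho> \<subseteq> \<Omega>"
    "\<And>t b. 0 \<le> t \<Longrightarrow> t < \<tau> \<Longrightarrow> b \<in> ball c \<rho> \<Longrightarrow> norm (displacement t b) \<le> C * t"
    "\<And>t x y. 0 \<le> t \<Longrightarrow> t < \<tau> \<Longrightarrow> x \<in> ball c \<rho> \<Longrightarrow> y \<in> ball c \<rho> \<Longrightarrow>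
      norm (displacement t y - displacement t x) \<le> K * t * norm (y - x)"
proof -
  obtain \<rho> \<tau> C where *: "\<rho> > 0" "\<tau> > 0" "C > 0" "ball c \<rho> \<subseteq> \<Omega>"
    "\<And>t b. 0 \<le> t \<Longrightarrow> t < \<tau> \<Longrightarrow> b \<in> ball c \<rho> \<Longrightarrow> norm (displacement t b) \<le> C * t"
    by (rule displacement_linear_bound[OF assms]) blast
  show ?thesis
  proof (rule that[of "\<rho> / 8" \<tau> C "12 * C / \<rho>"])
    fix t x y
    assume t: "0 \<le> t" "t < \<tau>" and xy: "x \<in> ball c (\<rho> / 8)" "y \<in> ball c (\<rho> / 8)"
    have "norm (displacement t y - displacement t x) \<le> 12 * (C * t) / \<rho> * norm (y - x)"
      using *(4) t(1) *(5)[OF t] xy by (rule displacement_lipschitz)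
    then show "norm (displacement t y - displacement t x) \<le> 12 * C / \<rho> * t * norm (y - x)"
      by simp
  qed (use * in \<open>auto simp: subset_eq\<close>)
qed

text \<open>With Lipschitz constants of order \<open>k h\<close>, the iteration error is of order \<open>t\<^sup>2\<close> when
  \<open>n h \<le> t\<close>. Hence the quotients at times \<open>h \<le> t\<close> differ by \<open>O(t)\<close>, plus a rounding error
  \<open>O(h / t)\<close> from writing \<open>t\<close> as a multiple of \<open>h\<close>. Choosing \<open>t\<close> small first and then \<open>h\<close> small
  relative to \<open>t\<close> gives the Cauchy property.\<close>

lemma displacement_quotient_converges:
  assumes b: "b \<in> \<Omega>"
  shows "\<exists>D. ((\<lambda>h. inverse h *\<^sub>R displacement h b) \<longlongrightarrow> D) (at_right 0)"
proof -
  obtain \<rho> \<tau> C K where est: "\<rho> > 0" "\<tau> > 0" "C > 0" "K > 0" "ball b \<rho> \<subseteq> \<Omega>"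
    "\<And>t x. 0 \<le> t \<Longrightarrow> t < \<tau> \<Longrightarrow> x \<in> ball b \<rho> \<Longrightarrow> norm (displacement t x) \<le> C * t"
    "\<And>t x y. 0 \<le> t \<Longrightarrow> t < \<tau> \<Longrightarrow> x \<in> ball b \<rho> \<Longrightarrow> y \<in> ball b \<rho> \<Longrightarrow>
      norm (displacement t y - displacement t x) \<le> K * t * norm (y - x)"
    by (rule displacement_local_estimates[OF b]) blast
  define \<sigma> where "\<sigma> = min \<tau> (\<rho> / C)"
  have \<sigma>: "\<sigma> > 0" "\<sigma> \<le> \<tau>"
    using est by (simp_all add: \<sigma>_def)
  have bb: "b \<in> ball b \<rho>"
    using est by simp
  have orbit: "f t b \<in> ball b \<rho>" if "0 \<le> t" "t < \<sigma>" for t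
  proof -
    have "C * t < \<rho>"
      using that est(3) by (simp add: \<sigma>_def field_simps)
    then show ?thesis
      using est(6)[of t b] that \<sigma> bb by (simp add: dist_norm norm_minus_commute)
  qed
  have main: "norm (inverse t *\<^sub>R displacement t b - inverse h *\<^sub>R displacement h b)
      \<le> 2 * C * h / t + K * C * t" if h: "0 < h" "h \<le> t" and t: "t < \<sigma>" for h t
  proof -
    define n where "n = nat \<lfloor>t / h\<rfloor>"
    define r where "r = t - real n * h"
    have "0 \<le> t / h"
      using h by simp
    then have "real n \<le> t / h" "t / h < real n + 1"
      unfolding n_def by linarith+
    then have n: "real n * h \<le> t" "r < h" "0 \<le> r"
      using h by (simp_all add: r_def field_simps)
    have dh: "norm (displacement h b) \<le> C * h"
      using est(6)[of h b] h t \<sigma> bb by simp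
    have "norm (displacement (real n * h) b - real n *\<^sub>R displacement h b)
        \<le> real n * (K * t) * norm (displacement h b)"
    proof (rule displacement_iterate[OF b])
      fix k
      assume "k < n"
      then have kn: "real k * h \<le> real n * h"
        using h by (intro mult_right_mono) auto
      have k: "0 \<le> real k * h" "real k * h \<le> t"
        using h order_trans[OF kn n(1)] by simp_all
      have "norm (displacement (real k * h) (f h b) - displacement (real k * h) b)
          \<le> K * (real k * h) * norm (f h b - b)"
        using k h t \<sigma> bb orbit[of h] by (intro est(7)) auto
      also have "\<dots> \<le> K * t * norm (f h b - b)"
        using k est(4) by (intro mult_right_mono mult_left_mono) auto
      finally show "norm (displacement (real k * h) (f h b) - displacement (real k * h) b)
          \<le> K * t * norm (displacement h b)" .
    qed (use h in simp)
    also have "\<dots> \<le> real n * (K * t) * (C * h)"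
      using dh est(4) h by (intro mult_left_mono) auto
    also have "\<dots> = K * C * t * (real n * h)"
      by simp
    also have "\<dots> \<le> K * C * t * t"
      using n est h by (intro mult_left_mono) auto
    finally have A: "norm (displacement (real n * h) b - real n *\<^sub>R displacement h b)
      \<le> K * C * t * t" .
    have nonneg: "0 \<le> real n * h"
      using h by simp
    have "norm (displacement r (f (real n * h) b)) \<le> C * r"
      using n nonneg h t \<sigma> by (intro est(6) orbit) auto
    also have "\<dots> \<le> C * h"
      using n est(3) by (intro mult_left_mono) auto
    finally have B: "norm (displacement r (f (real n * h) b)) \<le> C * h" .
    have "norm ((r / h) *\<^sub>R displacement h b) = r / h * norm (displacement h b)"
      using n h by simp
    also have "\<dots> \<le> r / h * (C * h)"
      using dh n h by (intro mult_left_mono) auto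
    also have "\<dots> \<le> C * h"
      using n est(3) h by simp
    finally have D: "norm ((r / h) *\<^sub>R displacement h b) \<le> C * h" .
    have "f t b = f r (f (real n * h) b)"
      using f_add[of r "real n * h" b] n nonneg b by (simp add: r_def)
    moreover have "t / h = real n + r / h"
      using h by (simp add: r_def field_simps)
    ultimately have "displacement t b - (t / h) *\<^sub>R displacement h b
        = displacement r (f (real n * h) b)
          + (displacement (real n * h) b - real n *\<^sub>R displacement h b)
          - (r / h) *\<^sub>R displacement h b"
      by (simp only: scaleR_add_left) simp
    also have "norm \<dots> \<le> norm (displacement r (f (real n * h) b))
          + norm (displacement (real n * h) b - real n *\<^sub>R displacement h b)
          + norm ((r / h) *\<^sub>R displacement h b)"
      by (intro order_trans[OF norm_triangle_ineq4] add_mono norm_triangle_ineq order_refl)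
    also have "\<dots> \<le> C * h + K * C * t * t + C * h"
      by (intro add_mono A B D)
    finally have "norm (displacement t b - (t / h) *\<^sub>R displacement h b)
      \<le> 2 * C * h + K * C * t * t"
      by simp
    then have *: "inverse t * norm (displacement t b - (t / h) *\<^sub>R displacement h b)
        \<le> inverse t * (2 * C * h + K * C * t * t)"
      using h by (intro mult_left_mono) auto
    have "inverse t *\<^sub>R displacement t b - inverse h *\<^sub>R displacement h b
        = inverse t *\<^sub>R (displacement t b - (t / h) *\<^sub>R displacement h b)"
      using h by (simp add: scaleR_right_diff_distrib field_simps)
    then have "norm (inverse t *\<^sub>R displacement t b - inverse h *\<^sub>R displacement h b)
        = inverse t * norm (displacement t b - (t / h) *\<^sub>R displacement h b)"
      using h by simp
    also note *
    also have "inverse t * (2 * C * h + K * C * t * t) = 2 * C * h / t + K * C * t"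
      using h by (simp add: field_simps)
    finally show ?thesis .
  qed
  show ?thesis
  proof (rule Cauchy_tendsto)
    fix e :: real
    assume "e > 0"
    define t where "t = min (\<sigma> / 2) (e / (4 * (K * C)))"
    have "t \<le> \<sigma> / 2" "0 < t"
      using \<sigma> \<open>e > 0\<close> est by (simp_all add: t_def)
    then have t: "0 < t" "t < \<sigma>"
      using \<sigma> by simp_all
    have "t \<le> e / (4 * (K * C))"
      by (simp add: t_def)
    then have KCt: "K * C * t \<le> e / 4"
      using est by (simp add: field_simps)
    define \<eta> where "\<eta> = min t (e * t / (8 * C))"
    have "\<eta> > 0"
      using t \<open>e > 0\<close> est by (simp add: \<eta>_def)
    then have ev: "eventually (\<lambda>h. 0 < h \<and> h < \<eta>) (at_right 0)"
      by (auto simp: eventually_at_right_field)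
    have half: "dist (inverse t *\<^sub>R displacement t b) (inverse h *\<^sub>R displacement h b) < e / 2"
      if "0 < h" "h < \<eta>" for h
    proof -
      have "h < e * t / (8 * C)" "h \<le> t"
        using that by (auto simp: \<eta>_def)
      then have "2 * C * h / t < e / 4"
        using t est by (simp add: field_simps)
      then show ?thesis
        using main[OF that(1) \<open>h \<le> t\<close> t(2)] KCt unfolding dist_norm by linarith
    qed
    have "dist (inverse h *\<^sub>R displacement h b) (inverse h' *\<^sub>R displacement h' b) < e"
      if "0 < h \<and> h < \<eta>" "0 < h' \<and> h' < \<eta>" for h h'
      using that by (intro dist_triangle_half_r[OF half half]) simp_all
    with ev show "\<exists>P. eventually P (at_right 0) \<and> (\<forall>h h'. P h \<and> P h' \<longrightarrow>
        dist (inverse h *\<^sub>R displacement h b) (inverse h' *\<^sub>R displacement h' b) < e)"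
      by blast
  qed simp
qed

section \<open>The generator\<close>

definition generator :: "'a \<Rightarrow> 'a"
  where "generator b = - Lim (at_right 0) (\<lambda>h. inverse h *\<^sub>R displacement h b)"

lemma displacement_quotient_tendsto:
  assumes "b \<in> \<Omega>"
  shows "((\<lambda>h. inverse h *\<^sub>R displacement h b) \<longlongrightarrow> - generator b) (at_right 0)"
  using displacement_quotient_converges[OF assms] tendsto_Lim[of "at_right (0::real)"]
  by (auto simp: generator_def)

lemma generator_quotient_tendsto:
  assumes "b \<in> \<Omega>"
  shows "((\<lambda>h. (- inverse h) *\<^sub>R displacement h b) \<longlongrightarrow> generator b) (at_right 0)"
  using tendsto_minus[OF displacement_quotient_tendsto[OF assms]] by simp

lemma analytic_generator: "banach_analytic_on \<Omega> generator"
  unfolding banach_analytic_on_def locally_bounded_on_def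
proof (intro conjI ballI)
  fix c
  assume "c \<in> \<Omega>"
  then obtain \<rho> \<tau> C where est: "\<rho> > 0" "\<tau> > 0" "C > 0" "ball c \<rho> \<subseteq> \<Omega>"
    "\<And>t b. 0 \<le> t \<Longrightarrow> t < \<tau> \<Longrightarrow> b \<in> ball c \<rho> \<Longrightarrow> norm (displacement t b) \<le> C * t"
    by (rule displacement_linear_bound) blast
  have bd: "norm ((- inverse h) *\<^sub>R displacement h b) \<le> C"
    if "0 < h" "h < \<tau>" "b \<in> ball c \<rho>" for h b
  proof -
    have "norm ((- inverse h) *\<^sub>R displacement h b) = norm (displacement h b) / h"
      using that by (simp add: divide_inverse mult.commute del: scaleR_minus_left)
    also have "\<dots> \<le> C"
      using est(5)[of h b] that by (simp add: pos_divide_le_eq)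
    finally show ?thesis .
  qed
  show "gateaux_differentiable_at generator c"
  proof (rule bounded_gateaux_limit)
    show "gateaux_differentiable_at (\<lambda>b. (- inverse h) *\<^sub>R displacement h b) b"
      if "0 < h" "h < \<tau>" "b \<in> ball c \<rho>" for h b
      using that est(4) by (intro gateaux_displacement) auto
    show "((\<lambda>h. (- inverse h) *\<^sub>R displacement h b) \<longlongrightarrow> generator b) (at_right 0)"
      if "b \<in> ball c \<rho>" for b
      using that est(4) by (intro generator_quotient_tendsto) auto
  qed (use est bd in auto)
  have "norm (generator b) \<le> C" if b: "b \<in> ball c \<rho>" for b
  proof (rule tendsto_upperbound)
    show "((\<lambda>h. norm ((- inverse h) *\<^sub>R displacement h b)) \<longlongrightarrow> norm (generator b)) (at_right 0)"
      using b est(4) by (intro tendsto_norm generator_quotient_tendsto) auto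
    have "eventually (\<lambda>h. 0 < h \<and> h < \<tau>) (at_right 0)"
      using est(2) by (auto simp: eventually_at_right_field)
    then show "eventually (\<lambda>h. norm ((- inverse h) *\<^sub>R displacement h b) \<le> C) (at_right 0)"
      by eventually_elim (use bd b in auto)
  qed simp
  then have "bounded (generator ` (ball c \<rho> \<inter> \<Omega>))"
    by (auto simp: bounded_iff intro!: exI[of _ C])
  with est(1) show "\<exists>\<delta>>0. bounded (generator ` (ball c \<delta> \<inter> \<Omega>))"
    by blast
qed

text \<open>Since \<open>f t b = f s (f (t - s) b)\<close>, the increment compares \<open>f s\<close> at two points at distance
  \<open>O(t - s)\<close>. The displacement bound on \<open>[0, t]\<close> makes the maps \<open>f s\<close> with \<open>s \<le> t\<close>
  uniformly Lipschitz near \<open>b\<close>.\<close>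

lemma left_lipschitz_in_time:
  assumes b: "b \<in> \<Omega>" and t: "t \<ge> 0"
  obtains d B where "d > 0" "B > 0"
    "\<And>s. 0 \<le> s \<Longrightarrow> t - d < s \<Longrightarrow> s \<le> t \<Longrightarrow> norm (f t b - f s b) \<le> B * (t - s)"
proof -
  obtain \<delta> where \<delta>: "\<delta> > 0" "ball b \<delta> \<subseteq> \<Omega>"
    "\<And>T. \<exists>M. \<forall>t x. 0 \<le> t \<longrightarrow> t \<le> T \<longrightarrow> x \<in> ball b \<delta> \<longrightarrow> norm (displacement t x) \<le> M"
    by (rule local_ball[OF b]) blast
  obtain M where M: "\<And>s x. 0 \<le> s \<Longrightarrow> s \<le> t \<Longrightarrow> x \<in> ball b \<delta> \<Longrightarrow> norm (displacement s x) \<le> M"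
    using \<delta>(3)[of t] by blast
  obtain \<rho> \<tau> C where est: "\<rho> > 0" "\<tau> > 0" "C > 0" "ball b \<rho> \<subseteq> \<Omega>"
    "\<And>t x. 0 \<le> t \<Longrightarrow> t < \<tau> \<Longrightarrow> x \<in> ball b \<rho> \<Longrightarrow> norm (displacement t x) \<le> C * t"
    by (rule displacement_linear_bound[OF b]) blast
  have "M \<ge> 0"
    using M[of t b] t \<delta>(1) norm_ge_zero[of "displacement t b"] by (simp del: norm_ge_zero)
  define \<Lambda> where "\<Lambda> = 12 * M / \<delta> + 1"
  have \<Lambda>: "\<Lambda> \<ge> 1"
    using \<open>M \<ge> 0\<close> \<delta>(1) by (simp add: \<Lambda>_def)
  show ?thesis
  proof (rule that[of "min \<tau> (\<delta> / (8 * C))" "\<Lambda> * C"])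
    fix s
    assume s: "0 \<le> s" "t - min \<tau> (\<delta> / (8 * C)) < s" "s \<le> t"
    define u where "u = t - s"
    have u: "0 \<le> u" "u < \<tau>" "u < \<delta> / (8 * C)"
      using s by (auto simp: u_def)
    have du: "norm (displacement u b) \<le> C * u"
      using est(1) u by (intro est(5)) auto
    also have "C * u < \<delta> / 8"
      using u(3) est(3) by (simp add: field_simps)
    finally have fu: "f u b \<in> ball b (\<delta> / 8)"
      by (simp add: dist_norm norm_minus_commute)
    have "f t b = f s (f u b)"
      using f_add[of s u b] s u b by (simp add: u_def)
    then have "norm (f t b - f s b)
        = norm ((displacement s (f u b) - displacement s b) + displacement u b)"
      by simp
    also have "\<dots> \<le> norm (displacement s (f u b) - displacement s b) + norm (displacement u b)"
      by (rule norm_triangle_ineq)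
    also have "norm (displacement s (f u b) - displacement s b)
        \<le> 12 * M / \<delta> * norm (displacement u b)"
      using \<delta>(1) s fu by (intro displacement_lipschitz[OF \<delta>(2)] M) auto
    also have "12 * M / \<delta> * norm (displacement u b) + norm (displacement u b)
        = \<Lambda> * norm (displacement u b)"
      by (simp add: \<Lambda>_def distrib_right)
    also have "\<dots> \<le> \<Lambda> * (C * u)"
      using du \<Lambda> by (intro mult_left_mono) auto
    finally show "norm (f t b - f s b) \<le> \<Lambda> * C * (t - s)"
      by (simp add: u_def)
  qed (use est \<delta> \<Lambda> in auto)
qed

text \<open>A first-order expansion that is uniform in the base point \<open>y\<close> near \<open>x\<close>, as needed for left
  derivatives, where the base point is an earlier point of the orbit.\<close>

lemma displacement_near_generator:
  assumes x: "x \<in> \<Omega>" and e: "e > 0"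
  obtains \<eta> where "\<eta> > 0"
    "\<And>h y. 0 \<le> h \<Longrightarrow> h < \<eta> \<Longrightarrow> norm (y - x) < \<eta> \<Longrightarrow>
      norm (displacement h y + h *\<^sub>R generator x) \<le> e * h"
proof -
  obtain \<rho> \<tau> C K where est: "\<rho> > 0" "\<tau> > 0" "C > 0" "K > 0" "ball x \<rho> \<subseteq> \<Omega>"
    "\<And>t b. 0 \<le> t \<Longrightarrow> t < \<tau> \<Longrightarrow> b \<in> ball x \<rho> \<Longrightarrow> norm (displacement t b) \<le> C * t"
    "\<And>t y z. 0 \<le> t \<Longrightarrow> t < \<tau> \<Longrightarrow> y \<in> ball x \<rho> \<Longrightarrow> z \<in> ball x \<rho> \<Longrightarrow>
      norm (displacement t z - displacement t y) \<le> K * t * norm (z - y)"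
    by (rule displacement_local_estimates[OF x]) blast
  have "eventually (\<lambda>h. dist (inverse h *\<^sub>R displacement h x) (- generator x) < e / 2) (at_right 0)"
    using displacement_quotient_tendsto[OF x] e by (intro tendstoD) auto
  then obtain \<sigma> where \<sigma>: "\<sigma> > 0" "\<And>h. 0 < h \<Longrightarrow> h < \<sigma> \<Longrightarrow>
      dist (inverse h *\<^sub>R displacement h x) (- generator x) < e / 2"
    by (auto simp: eventually_at_right_field)
  show ?thesis
  proof (rule that[of "min (min \<tau> \<sigma>) (min \<rho> (e / (2 * K)))"])
    fix h y
    assume h: "0 \<le> h" "h < min (min \<tau> \<sigma>) (min \<rho> (e / (2 * K)))"
      and y: "norm (y - x) < min (min \<tau> \<sigma>) (min \<rho> (e / (2 * K)))"
    have center: "norm (displacement h x + h *\<^sub>R generator x) \<le> e / 2 * h"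
    proof (cases "h = 0")
      case True
      then show ?thesis
        using f_zero[OF x] by simp
    next
      case False
      with h have "h > 0"
        by simp
      then have "displacement h x + h *\<^sub>R generator x
          = h *\<^sub>R (inverse h *\<^sub>R displacement h x - (- generator x))"
        by (simp add: algebra_simps)
      then have "norm (displacement h x + h *\<^sub>R generator x)
          = h * dist (inverse h *\<^sub>R displacement h x) (- generator x)"
        using \<open>h > 0\<close> by (simp add: dist_norm)
      also have "\<dots> \<le> h * (e / 2)"
        using \<sigma>(2)[of h] \<open>h > 0\<close> h by (intro mult_left_mono) auto
      finally show ?thesis
        by (simp add: mult.commute)
    qed
    have "norm (displacement h y - displacement h x) \<le> K * h * norm (y - x)"
      using h y est(1) by (intro est(7)) (auto simp: dist_norm norm_minus_commute)
    also have "\<dots> \<le> K * h * (e / (2 * K))"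
      using y h est(4) by (intro mult_left_mono) auto
    also have "\<dots> = e / 2 * h"
      using est(4) by simp
    finally have "norm (displacement h y - displacement h x) \<le> e / 2 * h" .
    moreover have "displacement h y + h *\<^sub>R generator x
        = (displacement h y - displacement h x) + (displacement h x + h *\<^sub>R generator x)"
      by simp
    then have "norm (displacement h y + h *\<^sub>R generator x)
        \<le> norm (displacement h y - displacement h x) + norm (displacement h x + h *\<^sub>R generator x)"
      by (rule ssubst) (rule norm_triangle_ineq)
    ultimately show "norm (displacement h y + h *\<^sub>R generator x) \<le> e * h"
      using center by linarith
  qed (use est \<sigma> e in auto)
qed

lemma orbit_has_vector_derivative:
  assumes b: "b \<in> \<Omega>" and t: "t \<ge> 0"
  shows "((\<lambda>s. f s b) has_vector_derivative - generator (f t b)) (at t within {0..})"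
  unfolding has_vector_derivative_def has_derivative_within_alt
proof (intro conjI allI impI)
  show "bounded_linear (\<lambda>r. r *\<^sub>R (- generator (f t b)))"
    by (rule bounded_linear_scaleR_left)
next
  fix e :: real
  assume e: "e > 0"
  let ?x = "f t b"
  have x: "?x \<in> \<Omega>"
    using f_mem[OF t b] .
  obtain \<eta> where \<eta>: "\<eta> > 0"
    "\<And>h y. 0 \<le> h \<Longrightarrow> h < \<eta> \<Longrightarrow> norm (y - ?x) < \<eta> \<Longrightarrow>
      norm (displacement h y + h *\<^sub>R generator ?x) \<le> e * h"
    by (rule displacement_near_generator[OF x e]) blast
  obtain d B where B: "d > 0" "B > 0"
    "\<And>s. 0 \<le> s \<Longrightarrow> t - d < s \<Longrightarrow> s \<le> t \<Longrightarrow> norm (f t b - f s b) \<le> B * (t - s)"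
    by (rule left_lipschitz_in_time[OF b t]) blast
  let ?d = "min d (min \<eta> (\<eta> / B))"
  have "norm (f s b - f t b - (s - t) *\<^sub>R (- generator ?x)) \<le> e * norm (s - t)"
    if s: "s \<ge> 0" "norm (s - t) < ?d" for s
  \<comment> \<open>The increment is a displacement at the orbit point of the earlier of the two times.\<close>
  proof (cases "t \<le> s")
    case True
    have "f s b = f (s - t) ?x"
      using f_add[of "s - t" t b] True t b by simp
    then show ?thesis
      using \<eta>(2)[of "s - t" ?x] True s(2) \<eta>(1) by simp
  next
    case False
    have "norm (f t b - f s b) \<le> B * (t - s)"
      using False s by (intro B) auto
    also have "\<dots> < \<eta>"
      using False s(2) B(2) by (simp add: field_simps)
    finally have near: "norm (f s b - ?x) < \<eta>"
      by (simp add: norm_minus_commute)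
    have "f t b = f (t - s) (f s b)"
      using f_add[of "t - s" s b] False s b by simp
    then have "norm (f t b - f s b + (t - s) *\<^sub>R generator ?x) \<le> e * (t - s)"
      using \<eta>(2)[of "t - s" "f s b"] near False s(2) by simp
    moreover have "f s b - f t b - (s - t) *\<^sub>R (- generator ?x)
        = - (f t b - f s b + (t - s) *\<^sub>R generator ?x)"
      by (simp add: algebra_simps)
    then have "norm (f s b - f t b - (s - t) *\<^sub>R (- generator ?x))
        = norm (f t b - f s b + (t - s) *\<^sub>R generator ?x)"
      by (simp only: norm_minus_cancel)
    moreover have "norm (s - t) = t - s"
      using False by simp
    ultimately show ?thesis
      by simp
  qed
  moreover have "?d > 0"
    using B \<eta>(1) by simp
  ultimately show "\<exists>d>0. \<forall>s\<in>{0..}. norm (s - t) < d \<longrightarrow>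
      norm (f s b - f t b - (s - t) *\<^sub>R (- generator ?x)) \<le> e * norm (s - t)"
    by (intro exI[of _ ?d]) simp
qed

end

theorem proposition3p3:
  fixes \<Omega> :: "'a::complex_banach_algebra_1 set"
    and f :: "real \<Rightarrow> 'a \<Rightarrow> 'a"
  assumes "open \<Omega>"
    and "composition_semigroup_on \<Omega> f"
    and "\<And>t. t \<ge> 0 \<Longrightarrow> banach_analytic_on \<Omega> (f t)"
    and "\<And>b'. b' \<in> \<Omega> \<Longrightarrow> \<exists>\<delta>>0.
      uniform_limit (ball b' \<delta> \<inter> \<Omega>) (\<lambda>t b. f t b - b) (\<lambda>b. 0) (at_right 0) \<and>
      (\<forall>T>0. bounded ((\<lambda>(t, b). f t b - b) ` ({0..T} \<times> (ball b' \<delta> \<inter> \<Omega>))))"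
  shows "\<exists>\<Phi>. banach_analytic_on \<Omega> \<Phi> \<and>
    (\<forall>b\<in>\<Omega>. \<forall>t\<ge>0. ((\<lambda>s. f s b) has_vector_derivative - \<Phi> (f t b)) (at t within {0..}))"
proof -
  interpret analytic_semigroup \<Omega> f
    by unfold_locales (fact assms)+
  show ?thesis
    using analytic_generator orbit_has_vector_derivative by (intro exI[of _ generator]) simp
qed

end
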